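(* Let $(P,d)$ be a finite metric space with $n=|P|$, and let $k\in\mathbb{N}$ and $\alpha\in\mathbb{R}_{>0}$. If there exists a feasible solution for the $\alpha$-fair $k$-center problem on $P$, then Algorithm $(2,2)$-ApproxFairCenter$(k,\alpha)$ computes a $(2,2)$-approximation for the $\alpha$-fair $k$-center problem in time $O(n^2+kn\log n)$.
   Context: Distances $d(x,y)$ for $x,y\in P$ can be computed in constant time. For $C\subseteq P$ and $p\in P$, $d(p,C):=\min_{c\in C}d(p,c)$, with $d(p,\emptyset):=\infty$, and $\mathrm{cost}(P,C):=\max_{p\in P}d(p,C)$. For $p\in P$, $r\ge0$, $B(p,r):=\{q\in P: d(p,q)\le r\}$, and the $k$-fair radius is $r_k(p):=\inf\{r\ge0: |B(p,r)|\ge n/k\}$. A set $C\subseteq P$ is $(\alpha,k)$-fair if $d(p,C)\le\alpha r_k(p)$ for all $p\in P$; if also $|C|\le k$ it is a feasible solution for the $\alpha$-fair $k$-center problem, which asks for a feasible solution minimizing $\mathrm{cost}(P,C)$; let $\Delta^*$ be the optimal cost. A set $C\subseteq P$ of size $k$ is a $(\beta,\gamma)$-approximation for $\alpha$-fair $k$-center if $\mathrm{cost}(P,C)\le\beta\Delta^*$ and $C$ is $(\gamma\alpha,k)$-fair. Procedure $\mathrm{FairCenter}(k,\alpha,\Delta,r)$: order $P=\{p_1,\dots,p_n\}$ so that $r(p_1)\le\dots\le r(p_n)$; $C:=\emptyset$; for $i=1,\dots,n$: if $d(p_i,C)>2\min\{\alpha r(p_i),\Delta\}$ then $C:=C\cup\{p_i\}$;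 return $C$. Algorithm $(2,2)$-ApproxFairCenter$(k,\alpha)$: let $D$ be the set of pairwise distances in $P$; compute $r_k(p)$ for all $p\in P$; do a binary search over $D$ to find the smallest $\Delta\in D$ with $|\mathrm{FairCenter}(k,\alpha,\Delta,r_k)|\le k$; if no such $\Delta$ exists, report that no feasible solution exists; otherwise return $\mathrm{FairCenter}(k,\alpha,\Delta,r_k)$.
   Formalization: An approximation is a set of size at most k, not exactly k: for three points at mutual distance 1, k=2, α=1, the algorithm returns one center, and no set of size k exists if k>n. The pairwise distances D include 0=d(p,p), needed for a one-point space. *)

theory Defs
  imports
    "HOL-Analysis.Abstract_Metric_Spaces"
    "HOL-Library.Extended_Real"
    "HOL-Library.Monad_Syntax"
begin

section \<open>Fair k-center\<close>

definition set_dist :: "('a \<Rightarrow> 'a \<Rightarrow> real) \<Rightarrow> 'a \<Rightarrow> 'a set \<Rightarrow> ereal" where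
  "set_dist d p C = (if C = {} then \<infinity> else ereal (MIN c\<in>C. d p c))"

definition cost :: "'a set \<Rightarrow> ('a \<Rightarrow> 'a \<Rightarrow> real) \<Rightarrow> 'a set \<Rightarrow> ereal" where
  "cost P d C = (MAX p\<in>P. set_dist d p C)"

definition pball :: "'a set \<Rightarrow> ('a \<Rightarrow> 'a \<Rightarrow> real) \<Rightarrow> 'a \<Rightarrow> real \<Rightarrow> 'a set" where
  "pball P d p r = {q \<in> P. d p q \<le> r}"

definition fair_radius :: "'a set \<Rightarrow> ('a \<Rightarrow> 'a \<Rightarrow> real) \<Rightarrow> nat \<Rightarrow> 'a \<Rightarrow> real" where
  "fair_radius P d k p = Inf {r. 0 \<le> r \<and> real (card P) / real k \<le> real (card (pball P d p r))}"

definition fair :: "'a set \<Rightarrow> ('a \<Rightarrow> 'a \<Rightarrow> real) \<Rightarrow> real \<Rightarrow> nat \<Rightarrow> 'a set \<Rightarrow> bool" where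
  "fair P d \<alpha> k C \<longleftrightarrow>
     C \<subseteq> P \<and> (\<forall>p\<in>P. set_dist d p C \<le> ereal (\<alpha> * fair_radius P d k p))"

definition feasible :: "'a set \<Rightarrow> ('a \<Rightarrow> 'a \<Rightarrow> real) \<Rightarrow> real \<Rightarrow> nat \<Rightarrow> 'a set \<Rightarrow> bool" where
  "feasible P d \<alpha> k C \<longleftrightarrow> fair P d \<alpha> k C \<and> card C \<le> k"

definition opt_cost :: "'a set \<Rightarrow> ('a \<Rightarrow> 'a \<Rightarrow> real) \<Rightarrow> real \<Rightarrow> nat \<Rightarrow> ereal" where
  "opt_cost P d \<alpha> k = Min (cost P d ` {C. feasible P d \<alpha> k C})"

text \<open>The size condition is \<open>card C \<le> k\<close>: the procedure below may stop with fewer than \<open>k\<close>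
  centers (and there is no set of \<open>k\<close> centers at all if \<open>k\<close> exceeds the number of points).\<close>

definition approximation ::
  "real \<Rightarrow> real \<Rightarrow> 'a set \<Rightarrow> ('a \<Rightarrow> 'a \<Rightarrow> real) \<Rightarrow> real \<Rightarrow> nat \<Rightarrow> 'a set \<Rightarrow> bool" where
  "approximation \<beta> \<gamma> P d \<alpha> k C \<longleftrightarrow>
     C \<subseteq> P \<and> card C \<le> k \<and> cost P d C \<le> ereal \<beta> * opt_cost P d \<alpha> k \<and> fair P d (\<gamma> * \<alpha>) k C"


section \<open>The algorithm as a mathematical function\<close>

text \<open>The list argument is the ordering of the points, assumed sorted by \<open>r\<close>.\<close>

primrec fair_center_loop ::
  "('a \<Rightarrow> 'a \<Rightarrow> real) \<Rightarrow> real \<Rightarrow> real \<Rightarrow> ('a \<Rightarrow> real) \<Rightarrow> 'a list \<Rightarrow> 'a set \<Rightarrow> 'a set" where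
  "fair_center_loop d \<alpha> \<Delta> r [] C = C"
| "fair_center_loop d \<alpha> \<Delta> r (p # ps) C =
     fair_center_loop d \<alpha> \<Delta> r ps
       (if set_dist d p C > ereal (2 * min (\<alpha> * r p) \<Delta>) then C \<union> {p} else C)"

definition fair_center ::
  "('a \<Rightarrow> 'a \<Rightarrow> real) \<Rightarrow> real \<Rightarrow> real \<Rightarrow> ('a \<Rightarrow> real) \<Rightarrow> 'a list \<Rightarrow> 'a set" where
  "fair_center d \<alpha> \<Delta> r ps = fair_center_loop d \<alpha> \<Delta> r ps {}"

text \<open>\<open>0 = d p p\<close> counts as a pairwise distance; otherwise a single point would have none.\<close>

definition pairwise_dists :: "'a set \<Rightarrow> ('a \<Rightarrow> 'a \<Rightarrow> real) \<Rightarrow> real set" where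
  "pairwise_dists P d = {d p q | p q. p \<in> P \<and> q \<in> P}"

definition approx_fair_center ::
  "('a \<Rightarrow> 'a \<Rightarrow> real) \<Rightarrow> nat \<Rightarrow> real \<Rightarrow> 'a list \<Rightarrow> 'a set option" where
  "approx_fair_center d k \<alpha> ps =
     (let P = set ps; r = fair_radius P d k;
          S = {\<Delta> \<in> pairwise_dists P d. card (fair_center d \<alpha> \<Delta> r ps) \<le> k}
      in if S = {} then None else Some (fair_center d \<alpha> (Min S) r ps))"


section \<open>Computations with running time\<close>

text \<open>A computation is its result together with its number of steps. Below, every function call
  (including every recursive call) costs one step. What a call does apart from further calls is a
  bounded number of constant-time operations: arithmetic and comparisons on numbers, distance
  queries, building and taking apart a list cell, a pair or an option.\<close>

datatype 'a timed = Timed (result: 'a) (time: nat)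

definition return :: "'a \<Rightarrow> 'a timed" where
  "return x = Timed x 0"

definition tick :: "unit timed" where
  "tick = Timed () 1"

definition bind_timed :: "'a timed \<Rightarrow> ('a \<Rightarrow> 'b timed) \<Rightarrow> 'b timed" where
  "bind_timed m f = (case m of Timed x s \<Rightarrow> case f x of Timed y t \<Rightarrow> Timed y (s + t))"

adhoc_overloading Monad_Syntax.bind \<rightleftharpoons> bind_timed

lemma bind_timed_cong [fundef_cong]:
  "m = m' \<Longrightarrow> (\<And>x. x = result m' \<Longrightarrow> f x = f' x) \<Longrightarrow> bind_timed m f = bind_timed m' f'"
  by (cases m') (simp add: bind_timed_def)

lemma result_simps [simp]:
  "result (return x) = x"
  "result (bind_timed m f) = result (f (result m))"
  by (simp_all add: return_def bind_timed_def split: timed.split)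

lemma time_simps [simp]:
  "time (return x) = 0"
  "time tick = 1"
  "time (bind_timed m f) = time m + time (f (result m))"
  by (simp_all add: return_def tick_def bind_timed_def split: timed.split)


subsection \<open>Lists\<close>

primrec length_tm :: "'a list \<Rightarrow> nat timed" where
  "length_tm [] = do { tick; return 0 }"
| "length_tm (x # xs) = do { tick; n \<leftarrow> length_tm xs; return (n + 1) }"

primrec append_tm :: "'a list \<Rightarrow> 'a list \<Rightarrow> 'a list timed" where
  "append_tm [] ys = do { tick; return ys }"
| "append_tm (x # xs) ys = do { tick; zs \<leftarrow> append_tm xs ys; return (x # zs) }"

primrec map_tm :: "('a \<Rightarrow> 'b timed) \<Rightarrow> 'a list \<Rightarrow> 'b list timed" where
  "map_tm f [] = do { tick; return [] }"
| "map_tm f (x # xs) = do { tick; y \<leftarrow> f x; ys \<leftarrow> map_tm f xs; return (y # ys) }"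

primrec nth_tm :: "'a list \<Rightarrow> nat \<Rightarrow> 'a timed" where
  "nth_tm [] i = do { tick; return undefined }"
| "nth_tm (x # xs) i = do { tick; case i of 0 \<Rightarrow> return x | Suc j \<Rightarrow> nth_tm xs j }"


subsection \<open>Merge sort by key\<close>

fun split_tm :: "'a list \<Rightarrow> ('a list \<times> 'a list) timed" where
  "split_tm [] = do { tick; return ([], []) }"
| "split_tm [x] = do { tick; return ([x], []) }"
| "split_tm (x # y # zs) = do { tick; (xs, ys) \<leftarrow> split_tm zs; return (x # xs, y # ys) }"

fun merge_tm :: "('a \<times> real) list \<Rightarrow> ('a \<times> real) list \<Rightarrow> ('a \<times> real) list timed" where
  "merge_tm [] ys = do { tick; return ys }"
| "merge_tm (x # xs) [] = do { tick; return (x # xs) }"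
| "merge_tm (x # xs) (y # ys) = do { tick;
     if snd x \<le> snd y
     then do { zs \<leftarrow> merge_tm xs (y # ys); return (x # zs) }
     else do { zs \<leftarrow> merge_tm (x # xs) ys; return (y # zs) } }"

lemma length_split_tm:
  "length (fst (result (split_tm xs))) = (length xs + 1) div 2"
  "length (snd (result (split_tm xs))) = length xs div 2"
  by (induction xs rule: split_tm.induct) (auto simp: case_prod_beta)

function msort_tm :: "('a \<times> real) list \<Rightarrow> ('a \<times> real) list timed" where
  "msort_tm [] = do { tick; return [] }"
| "msort_tm [x] = do { tick; return [x] }"
| "msort_tm (x # y # zs) = do { tick;
     (xs, ys) \<leftarrow> split_tm (x # y # zs);
     xs' \<leftarrow> msort_tm xs;
     ys' \<leftarrow> msort_tm ys;
     merge_tm xs' ys' }"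
  by pat_completeness auto
termination
proof (relation "measure length", goal_cases)
  case (2 x y zs _ _ xs ys)
  then have "xs = fst (result (split_tm (x # y # zs)))"
    by (metis fst_conv)
  then show ?case
    by (simp only: length_split_tm in_measure) simp
next
  case (3 x y zs _ _ xs ys _)
  then have "ys = snd (result (split_tm (x # y # zs)))"
    by (metis snd_conv)
  then show ?case
    by (simp only: length_split_tm in_measure) simp
qed simp


subsection \<open>Linear-time selection (median of medians)\<close>

primrec insort_tm :: "real \<Rightarrow> real list \<Rightarrow> real list timed" where
  "insort_tm x [] = do { tick; return [x] }"
| "insort_tm x (y # ys) = do { tick;
     if x \<le> y then return (x # y # ys)
     else do { zs \<leftarrow> insort_tm x ys; return (y # zs) } }"

primrec isort_tm :: "real list \<Rightarrow> real list timed" where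
  "isort_tm [] = do { tick; return [] }"
| "isort_tm (x # xs) = do { tick; ys \<leftarrow> isort_tm xs; insort_tm x ys }"

definition slow_select_tm :: "nat \<Rightarrow> real list \<Rightarrow> real timed" where
  "slow_select_tm i xs = do { tick; ys \<leftarrow> isort_tm xs; nth_tm ys i }"

definition slow_median_tm :: "real list \<Rightarrow> real timed" where
  "slow_median_tm xs = do { tick; n \<leftarrow> length_tm xs; slow_select_tm ((n - 1) div 2) xs }"

fun chop5_tm :: "real list \<Rightarrow> real list list timed" where
  "chop5_tm [] = do { tick; return [] }"
| "chop5_tm (a # b # c # d # e # xs) =
     do { tick; yss \<leftarrow> chop5_tm xs; return ([a, b, c, d, e] # yss) }"
| "chop5_tm xs = do { tick; return [xs] }"

primrec partition3_tm :: "real \<Rightarrow> real list \<Rightarrow> (real list \<times> real list \<times> real list) timed" where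
  "partition3_tm m [] = do { tick; return ([], [], []) }"
| "partition3_tm m (x # xs) = do { tick;
     (ls, es, gs) \<leftarrow> partition3_tm m xs;
     return (if x < m then (x # ls, es, gs)
             else if x = m then (ls, x # es, gs)
             else (ls, es, x # gs)) }"

text \<open>The first argument bounds the recursion depth. It only serves to make the recursion
  primitive: the lists of the recursive calls get shorter, so a bound of at least the length of
  the list is never used up.\<close>

primrec select_upto_tm :: "nat \<Rightarrow> nat \<Rightarrow> real list \<Rightarrow> real timed" where
  "select_upto_tm 0 i xs = do { tick; slow_select_tm i xs }"
| "select_upto_tm (Suc b) i xs = do { tick;
     n \<leftarrow> length_tm xs;
     if n \<le> 100 then slow_select_tm i xs
     else do {
       yss \<leftarrow> chop5_tm xs;
       ms \<leftarrow> map_tm slow_median_tm yss;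
       nm \<leftarrow> length_tm ms;
       m \<leftarrow> select_upto_tm b ((nm - 1) div 2) ms;
       (ls, es, gs) \<leftarrow> partition3_tm m xs;
       nl \<leftarrow> length_tm ls;
       ne \<leftarrow> length_tm es;
       if i < nl then select_upto_tm b i ls
       else if i < nl + ne then return m
       else select_upto_tm b (i - nl - ne) gs } }"

definition select_tm :: "nat \<Rightarrow> real list \<Rightarrow> real timed" where
  "select_tm i xs = do { tick; n \<leftarrow> length_tm xs; select_upto_tm n i xs }"


section \<open>The algorithm as a program\<close>

primrec set_dist_tm :: "('a \<Rightarrow> 'a \<Rightarrow> real) \<Rightarrow> 'a \<Rightarrow> 'a list \<Rightarrow> ereal timed" where
  "set_dist_tm d p [] = do { tick; return \<infinity> }"
| "set_dist_tm d p (c # cs) = do { tick; \<delta> \<leftarrow> set_dist_tm d p cs; return (min (ereal (d p c)) \<delta>) }"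

text \<open>Points come paired with their value of \<open>r\<close>; the argument \<open>j\<close> is the number of centers
  collected in \<open>C\<close>. The loop stops with \<open>None\<close> as soon as a center would have to be
  added to \<open>k\<close> centers, i.e. once it is certain that more than \<open>k\<close> centers would be returned;
  the loop thus takes \<open>O(k n)\<close> steps rather than \<open>O(n\<^sup>2)\<close>.\<close>

primrec fair_center_loop_tm ::
  "('a \<Rightarrow> 'a \<Rightarrow> real) \<Rightarrow> nat \<Rightarrow> real \<Rightarrow> real \<Rightarrow> ('a \<times> real) list \<Rightarrow> nat \<Rightarrow> 'a list \<Rightarrow>
     'a list option timed" where
  "fair_center_loop_tm d k \<alpha> \<Delta> [] j C = do { tick; return (Some C) }"
| "fair_center_loop_tm d k \<alpha> \<Delta> (pr # prs) j C = do { tick;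
     \<delta> \<leftarrow> set_dist_tm d (fst pr) C;
     if \<delta> > ereal (2 * min (\<alpha> * snd pr) \<Delta>)
     then if j = k then return None
          else fair_center_loop_tm d k \<alpha> \<Delta> prs (j + 1) (fst pr # C)
     else fair_center_loop_tm d k \<alpha> \<Delta> prs j C }"

definition fair_center_tm ::
  "('a \<Rightarrow> 'a \<Rightarrow> real) \<Rightarrow> nat \<Rightarrow> real \<Rightarrow> real \<Rightarrow> ('a \<times> real) list \<Rightarrow> 'a list option timed" where
  "fair_center_tm d k \<alpha> \<Delta> prs = do { tick;
     prs' \<leftarrow> msort_tm prs;
     fair_center_loop_tm d k \<alpha> \<Delta> prs' 0 [] }"

text \<open>For \<open>k > 0\<close> the fair radius of \<open>p\<close> is the \<open>\<lceil>n / k\<rceil>\<close>-th smallest distance from \<open>p\<close>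
  (indices count from \<open>0\<close>).\<close>

definition fair_radius_tm :: "('a \<Rightarrow> 'a \<Rightarrow> real) \<Rightarrow> nat \<Rightarrow> 'a list \<Rightarrow> nat \<Rightarrow> 'a \<Rightarrow> real timed" where
  "fair_radius_tm d k ps n p = do { tick;
     ds \<leftarrow> map_tm (\<lambda>q. return (d p q)) ps;
     select_tm ((n + k - 1) div k - 1) ds }"

primrec pairwise_dists_tm :: "('a \<Rightarrow> 'a \<Rightarrow> real) \<Rightarrow> 'a list \<Rightarrow> 'a list \<Rightarrow> real list timed" where
  "pairwise_dists_tm d [] qs = do { tick; return [] }"
| "pairwise_dists_tm d (p # ps) qs = do { tick;
     ds \<leftarrow> map_tm (\<lambda>q. return (d p q)) qs;
     es \<leftarrow> pairwise_dists_tm d ps qs;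
     append_tm ds es }"

text \<open>Binary search in an unsorted list \<open>D\<close> of candidates, halved by its median; sorting the
  \<open>n\<^sup>2\<close> distances first would be too slow. The first argument bounds the number of rounds (the
  length of \<open>D\<close> is sufficient), and \<open>best\<close> is what \<open>fair_center_tm\<close> returned for the smallest
  successful candidate so far.\<close>

primrec search_tm ::
  "nat \<Rightarrow> ('a \<Rightarrow> 'a \<Rightarrow> real) \<Rightarrow> nat \<Rightarrow> real \<Rightarrow> ('a \<times> real) list \<Rightarrow> real list \<Rightarrow> 'a list option \<Rightarrow>
     'a list option timed" where
  "search_tm 0 d k \<alpha> prs D best = do { tick; return best }"
| "search_tm (Suc b) d k \<alpha> prs D best = do { tick;
     if D = [] then return best
     else do {
       l \<leftarrow> length_tm D;
       \<Delta> \<leftarrow> select_tm ((l - 1) div 2) D;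
       (ls, es, gs) \<leftarrow> partition3_tm \<Delta> D;
       res \<leftarrow> fair_center_tm d k \<alpha> \<Delta> prs;
       case res of
         None \<Rightarrow> search_tm b d k \<alpha> prs gs best
       | Some C \<Rightarrow> search_tm b d k \<alpha> prs ls (Some C) } }"

text \<open>The result \<open>None\<close> is the report that there is no feasible solution.\<close>

definition approx_fair_center_tm ::
  "('a \<Rightarrow> 'a \<Rightarrow> real) \<Rightarrow> nat \<Rightarrow> real \<Rightarrow> 'a list \<Rightarrow> 'a list option timed" where
  "approx_fair_center_tm d k \<alpha> ps = do { tick;
     n \<leftarrow> length_tm ps;
     D \<leftarrow> pairwise_dists_tm d ps ps;
     prs \<leftarrow> map_tm (\<lambda>p. do { r \<leftarrow> fair_radius_tm d k ps n p; return (p, r) }) ps;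
     l \<leftarrow> length_tm D;
     search_tm l d k \<alpha> prs D None }"

end

theory Submission
  imports Defs "HOL-Library.Multiset" "HOL-Library.Log_Nat"
begin

text \<open>Distinct centers \<open>p\<close>, \<open>q\<close> chosen by the greedy procedure are more than
  \<open>2 min {\<alpha> max {r p, r q}, \<Delta>}\<close> apart because points come in the order of their radii.
  If \<open>\<Delta>\<close> is at least the optimal cost, an optimal solution has a center within
  \<open>min {\<alpha> r p, \<Delta>}\<close> of each \<open>p\<close>, and no two greedy centers can share it; so at most \<open>k\<close>
  centers are chosen. Since the optimal cost is itself a pairwise distance, the search ends at a value
  not exceeding it. For the running time, the median of medians shrinks the list to roughly seven
  tenths, so selection is linear; the search halves its \<open>n\<^sup>2\<close> candidates in each of \<open>O(log n)\<close>
  rounds, and a round costs \<open>O(n log n + k n)\<close> besides the selection, where the resulting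
  \<open>n log\<^sup>2 n\<close> is absorbed by \<open>n\<^sup>2\<close>.\<close>

section \<open>Results of the list procedures\<close>

lemma result_length_tm [simp]: "result (length_tm xs) = length xs"
  by (induction xs) auto

lemma time_length_tm [simp]: "time (length_tm xs) = length xs + 1"
  by (induction xs) auto

lemma result_append_tm [simp]: "result (append_tm xs ys) = xs @ ys"
  by (induction xs) auto

lemma time_append_tm [simp]: "time (append_tm xs ys) = length xs + 1"
  by (induction xs) auto

lemma result_map_tm [simp]: "result (map_tm f xs) = map (\<lambda>x. result (f x)) xs"
  by (induction xs) auto

lemma time_map_tm:
  "(\<And>x. x \<in> set xs \<Longrightarrow> time (f x) \<le> b) \<Longrightarrow> time (map_tm f xs) \<le> length xs * (b + 1) + 1"
proof (induction xs)
  case (Cons x xs)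
  have "time (map_tm f xs) \<le> length xs * (b + 1) + 1" and "time (f x) \<le> b"
    using Cons by auto
  then show ?case
    by simp
qed simp

lemma result_nth_tm [simp]: "i < length xs \<Longrightarrow> result (nth_tm xs i) = xs ! i"
  by (induction xs arbitrary: i) (auto split: nat.split)

lemma time_nth_tm: "time (nth_tm xs i) \<le> length xs + 1"
proof (induction xs arbitrary: i)
  case (Cons x xs)
  then show ?case
    by (cases i) auto
qed simp

lemma result_insort_tm [simp]: "result (insort_tm x xs) = insort x xs"
  by (induction xs) auto

lemma time_insort_tm: "time (insort_tm x xs) \<le> length xs + 1"
  by (induction xs) auto

lemma result_isort_tm [simp]: "result (isort_tm xs) = sort xs"
  by (induction xs) auto

lemma time_isort_tm: "time (isort_tm xs) \<le> (length xs + 1)\<^sup>2"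
proof (induction xs)
  case (Cons x xs)
  then show ?case
    using time_insort_tm[of x "sort xs"] by (simp add: power2_eq_square)
qed simp

lemma result_slow_select_tm [simp]:
  "i < length xs \<Longrightarrow> result (slow_select_tm i xs) = sort xs ! i"
  by (simp add: slow_select_tm_def)

lemma time_slow_select_tm: "time (slow_select_tm i xs) \<le> (length xs + 1)\<^sup>2 + length xs + 2"
  using time_isort_tm[of xs] time_nth_tm[of "sort xs" i] by (simp add: slow_select_tm_def)

lemma median_index_less: "xs \<noteq> [] \<Longrightarrow> (length xs - 1) div 2 < length xs"
  by (cases xs) auto

lemma result_slow_median_tm [simp]:
  "xs \<noteq> [] \<Longrightarrow> result (slow_median_tm xs) = sort xs ! ((length xs - 1) div 2)"
  using median_index_less[of xs] by (simp add: slow_median_tm_def)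

lemma time_slow_median_tm:
  assumes "length xs \<le> 5"
  shows "time (slow_median_tm xs) \<le> 50"
proof -
  \<comment> \<open>The 50 adds up from 36 + 5 + 2 for selecting among five elements, 5 + 1 for
    finding their number and 1 for the call itself.\<close>
  have "(length xs + 1)\<^sup>2 \<le> 6\<^sup>2"
    using assms by (intro power_mono) auto
  then show ?thesis
    using assms time_slow_select_tm[of "(length xs - 1) div 2" xs] by (simp add: slow_median_tm_def)
qed

lemma result_partition3_tm [simp]:
  "result (partition3_tm m xs) = (filter (\<lambda>x. x < m) xs, filter (\<lambda>x. x = m) xs, filter (\<lambda>x. m < x) xs)"
  by (induction xs) auto

lemma time_partition3_tm [simp]: "time (partition3_tm m xs) = length xs + 1"
  by (induction xs) auto

lemma time_chop5_tm: "time (chop5_tm xs) \<le> length xs + 1"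
  by (induction xs rule: chop5_tm.induct) auto

lemma length_chop5_tm: "length (result (chop5_tm xs)) = (length xs + 4) div 5"
  by (induction xs rule: chop5_tm.induct) auto

lemma chop5_tm_pieces: "ys \<in> set (result (chop5_tm xs)) \<Longrightarrow> ys \<noteq> [] \<and> length ys \<le> 5"
  by (induction xs rule: chop5_tm.induct) auto


section \<open>Selection\<close>

lemma sort_partition3:
  fixes xs :: "'a::linorder list"
  shows "sort xs = sort (filter (\<lambda>x. x < m) xs) @ filter (\<lambda>x. x = m) xs @ sort (filter (\<lambda>x. m < x) xs)"
proof (rule properties_for_sort)
  show "mset (sort (filter (\<lambda>x. x < m) xs) @ filter (\<lambda>x. x = m) xs @ sort (filter (\<lambda>x. m < x) xs)) = mset xs"
    by (induction xs) auto
  have "sorted (filter (\<lambda>x. x = m) xs)"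
    by (induction xs) auto
  then show "sorted (sort (filter (\<lambda>x. x < m) xs) @ filter (\<lambda>x. x = m) xs @ sort (filter (\<lambda>x. m < x) xs))"
    by (auto simp: sorted_append)
qed

lemma length_partition3:
  fixes xs :: "'a::linorder list"
  shows "length (filter (\<lambda>x. x < m) xs) + length (filter (\<lambda>x. x = m) xs) + length (filter (\<lambda>x. m < x) xs) = length xs"
  by (induction xs) auto

text \<open>Correctness holds for whatever pivot the inner call delivers:
  \<open>sort_partition3\<close> cuts the sorted list at any \<open>m\<close>, so the quality of the
  pivot affects the running time alone. When the depth bound runs out, the program falls back on
  sorting.\<close>

lemma result_select_upto_tm:
  "i < length xs \<Longrightarrow> result (select_upto_tm b i xs) = sort xs ! i"
proof (induction b arbitrary: i xs)
  case (Suc b)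
  let ?n = "length xs"
  show ?case
  proof (cases "?n \<le> 100")
    case False
    define m where "m = result (select_upto_tm b (((?n + 4) div 5 - 1) div 2)
      (map (\<lambda>x. result (slow_median_tm x)) (result (chop5_tm xs))))"
    let ?ls = "filter (\<lambda>x. x < m) xs" and ?es = "filter (\<lambda>x. x = m) xs" and ?gs = "filter (\<lambda>x. m < x) xs"
    have es: "?es ! j = m" if "j < length ?es" for j
      using nth_mem[OF that] by simp
    have "result (select_upto_tm (Suc b) i xs) = (if i < length ?ls then result (select_upto_tm b i ?ls)
        else if i < length ?ls + length ?es then m
        else result (select_upto_tm b (i - length ?ls - length ?es) ?gs))"
      using False by (simp add: length_chop5_tm m_def)
    also have "\<dots> = sort xs ! i"
      using Suc.IH[of i ?ls] Suc.IH[of "i - length ?ls - length ?es" ?gs] es[of "i - length ?ls"]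
        Suc.prems length_partition3[of m xs]
      by (subst sort_partition3[of xs m]) (auto simp: nth_append)
    finally show ?thesis .
  qed (use Suc.prems in simp)
qed simp

lemma result_select_tm [simp]: "i < length xs \<Longrightarrow> result (select_tm i xs) = sort xs ! i"
  by (simp add: select_tm_def result_select_upto_tm)

section \<open>Order statistics as counting conditions\<close>

lemma length_filter_sort [simp]: "length (filter Q (sort xs)) = length (filter Q xs)"
  by (metis filter_sort length_sort)

lemma length_filter_ge_drop:
  assumes "\<And>x. x \<in> set (drop i xs) \<Longrightarrow> Q x"
  shows "length xs - i \<le> length (filter Q xs)"
proof -
  have "filter Q (drop i xs) = drop i xs"
    using assms by (simp add: filter_id_conv)
  then have "length (filter Q xs) = length (filter Q (take i xs)) + length (drop i xs)"
    by (metis append_take_drop_id filter_append length_append)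
  then show ?thesis
    by simp
qed

lemma length_filter_ge_take:
  assumes "\<And>x. x \<in> set (take i xs) \<Longrightarrow> Q x" "i \<le> length xs"
  shows "i \<le> length (filter Q xs)"
proof -
  have "filter Q (take i xs) = take i xs"
    using assms by (simp add: filter_id_conv)
  then have "length (filter Q xs) = length (take i xs) + length (filter Q (drop i xs))"
    by (metis append_take_drop_id filter_append length_append)
  then show ?thesis
    using assms by simp
qed

lemma length_filter_ge_sort_nth:
  fixes xs :: "'a::linorder list"
  assumes "i < length xs" "m \<le> sort xs ! i"
  shows "length xs - i \<le> length (filter (\<lambda>x. m \<le> x) xs)"
proof -
  have "m \<le> x" if x: "x \<in> set (drop i (sort xs))" for x
  proof -
    obtain j where "x = sort xs ! (i + j)" "i + j < length xs"
      using x by (auto simp: in_set_conv_nth)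
    then show ?thesis
      using sorted_nth_mono[of "sort xs" i "i + j"] assms by auto
  qed
  then show ?thesis
    using length_filter_ge_drop[of i "sort xs" "\<lambda>x. m \<le> x"] by simp
qed

lemma length_filter_le_sort_nth:
  fixes xs :: "'a::linorder list"
  assumes "i < length xs" "sort xs ! i \<le> m"
  shows "i < length (filter (\<lambda>x. x \<le> m) xs)"
proof -
  have "x \<le> m" if x: "x \<in> set (take (Suc i) (sort xs))" for x
  proof -
    obtain j where "x = sort xs ! j" "j \<le> i"
      using x by (auto simp: in_set_conv_nth)
    then show ?thesis
      using sorted_nth_mono[of "sort xs" j i] assms by auto
  qed
  then show ?thesis
    using length_filter_ge_take[of "Suc i" "sort xs" "\<lambda>x. x \<le> m"] assms by simp
qed

text \<open>Serves to turn the ball-size condition of the fair radius into a bound on a single order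
  statistic. The inequality on the right is strict because indices start at 0.\<close>

lemma sort_nth_le_iff:
  fixes xs :: "'a::linorder list"
  assumes "i < length xs"
  shows "sort xs ! i \<le> m \<longleftrightarrow> i < length (filter (\<lambda>x. x \<le> m) xs)"
proof
  assume *: "i < length (filter (\<lambda>x. x \<le> m) xs)"
  define z where "z = sort xs ! i"
  \<comment> \<open>If the order statistic exceeded \<open>m\<close>, at least
    \<open>length xs - i\<close> elements would exceed \<open>m\<close>, leaving no more than
    \<open>i\<close> that do not.\<close>
  have "z \<le> m"
  proof (rule ccontr)
    assume "\<not> z \<le> m"
    then have "length xs - i \<le> length (filter (\<lambda>x. z \<le> x) xs)"
      using length_filter_ge_sort_nth[OF assms, of z] by (simp add: z_def)
    also have "\<dots> \<le> length (filter (\<lambda>x. \<not> x \<le> m) xs)"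
      using \<open>\<not> z \<le> m\<close> by (induction xs) auto
    finally show False
      using * sum_length_filter_compl[of "\<lambda>x. x \<le> m" xs] assms by simp
  qed
  then show "sort xs ! i \<le> m"
    by (simp add: z_def)
qed (use length_filter_le_sort_nth[OF assms] in simp)

text \<open>Both strict parts leave out the pivot itself, so with the median index each of them has
  at most half the length of the list and is strictly shorter. The binary search relies on
  this.\<close>

lemma length_filter_less_sort_nth:
  fixes xs :: "'a::linorder list"
  assumes "i < length xs"
  shows "length (filter (\<lambda>x. x < sort xs ! i) xs) \<le> i"
    "length (filter (\<lambda>x. sort xs ! i < x) xs) \<le> length xs - Suc i"
proof -
  show "length (filter (\<lambda>x. x < sort xs ! i) xs) \<le> i"
    using length_filter_ge_sort_nth[OF assms order_refl] assms
      sum_length_filter_compl[of "\<lambda>x. x < sort xs ! i" xs] by (simp add: not_less)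
  show "length (filter (\<lambda>x. sort xs ! i < x) xs) \<le> length xs - Suc i"
    using length_filter_le_sort_nth[OF assms order_refl] assms
      sum_length_filter_compl[of "\<lambda>x. x \<le> sort xs ! i" xs] by (simp add: not_le)
qed

text \<open>Every group of five whose median is at least \<open>m\<close> has three elements that are at least \<open>m\<close>;
  the summand \<open>2\<close> accounts for a last group of fewer than five elements.\<close>

lemma medians_ge:
  fixes xs :: "real list"
  shows "3 * length (filter (\<lambda>ys. m \<le> result (slow_median_tm ys)) (result (chop5_tm xs)))
    \<le> length (filter (\<lambda>x. m \<le> x) xs) + 2"
proof -
  \<comment> \<open>This count is three for a full group of five. For a shorter group it is at least
    one, and a shorter group occurs only at the end, where 3 <= 1 + 2.\<close>
  have group: "length ys - (length ys - 1) div 2 \<le> length (filter (\<lambda>x. m \<le> x) ys)"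
    if "ys \<noteq> []" "m \<le> result (slow_median_tm ys)" for ys :: "real list"
    using that by (intro length_filter_ge_sort_nth) (use median_index_less[of ys] in auto)
  show ?thesis
  proof (induction xs rule: chop5_tm.induct)
    case (2 a b c d e xs)
    then show ?case
      using group[of "[a, b, c, d, e]"] by (auto split: if_splits)
  next
    case ("3_1" a)
    then show ?case
      using group[of "[a]"] by auto
  next
    case ("3_2" a b)
    then show ?case
      using group[of "[a, b]"] by auto
  next
    case ("3_3" a b c)
    then show ?case
      using group[of "[a, b, c]"] by auto
  next
    case ("3_4" a b c d)
    then show ?case
      using group[of "[a, b, c, d]"] by auto
  qed simp
qed

text \<open>Mirror image of \<open>medians_ge\<close>. Since the lower median is taken, a last group
  of two guarantees just one element at most \<open>m\<close>, which the summand 2 still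
  covers.\<close>

lemma medians_le:
  fixes xs :: "real list"
  shows "3 * length (filter (\<lambda>ys. result (slow_median_tm ys) \<le> m) (result (chop5_tm xs)))
    \<le> length (filter (\<lambda>x. x \<le> m) xs) + 2"
proof -
  have group: "(length ys - 1) div 2 < length (filter (\<lambda>x. x \<le> m) ys)"
    if "ys \<noteq> []" "result (slow_median_tm ys) \<le> m" for ys :: "real list"
    using that by (intro length_filter_le_sort_nth) (use median_index_less[of ys] in auto)
  show ?thesis
  proof (induction xs rule: chop5_tm.induct)
    case (2 a b c d e xs)
    then show ?case
      using group[of "[a, b, c, d, e]"] by (auto split: if_splits)
  next
    case ("3_1" a)
    then show ?case
      using group[of "[a]"] by auto
  next
    case ("3_2" a b)
    then show ?case
      using group[of "[a, b]"] by auto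
  next
    case ("3_3" a b c)
    then show ?case
      using group[of "[a, b, c]"] by auto
  next
    case ("3_4" a b c d)
    then show ?case
      using group[of "[a, b, c, d]"] by auto
  qed simp
qed

text \<open>The recurrence is T(n) <= T(n/5) + T(7n/10) + O(n) up to rounding. The 10405 is the cost
  of the direct case at n = 100. In the recursive case the two calls use up 400 n + 1400 n; the
  remaining 200 n pay for the linear work, the rounding and the second copy of 10405 once n > 100.
  The quadratic fallback at depth 0 is excluded by \<open>length xs \<le> b\<close>.\<close>

lemma time_select_upto_tm:
  "i < length xs \<Longrightarrow> length xs \<le> b \<Longrightarrow> time (select_upto_tm b i xs) \<le> 2000 * length xs + 10405"
proof (induction b arbitrary: i xs)
  case (Suc b)
  let ?n = "length xs"
  show ?case
  proof (cases "?n \<le> 100")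
    case True
    have "(?n + 1)\<^sup>2 \<le> 101\<^sup>2"
      using True by (intro power_mono) auto
    then show ?thesis
      using True time_slow_select_tm[of i xs] by simp
  next
    case False
    define c where "c = (?n + 4) div 5"
    have c: "5 * c \<le> ?n + 4" "?n \<le> 5 * c"
      by (simp_all add: c_def)
    define ms where "ms = map (\<lambda>x. result (slow_median_tm x)) (result (chop5_tm xs))"
    have len: "length ms = c"
      by (simp add: ms_def length_chop5_tm c_def)
    define m where "m = result (select_upto_tm b ((c - 1) div 2) ms)"
    have mid: "(c - 1) div 2 < length ms"
      using False unfolding len c_def by linarith
    have m: "m = sort ms ! ((c - 1) div 2)"
      unfolding m_def using mid by (rule result_select_upto_tm)
    let ?ls = "filter (\<lambda>x. x < m) xs" and ?es = "filter (\<lambda>x. x = m) xs" and ?gs = "filter (\<lambda>x. m < x) xs"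
    have "3 * (c - (c - 1) div 2) \<le> length (filter (\<lambda>x. m \<le> x) xs) + 2"
      using length_filter_ge_sort_nth[OF mid, of m] medians_ge[of m xs] len
      by (simp add: m) (simp add: ms_def filter_map comp_def)
    moreover have "length (filter (\<lambda>x. m \<le> x) xs) + length ?ls = ?n"
      using sum_length_filter_compl[of "\<lambda>x. m \<le> x" xs] by (simp add: not_le)
    \<comment> \<open>At least half of the c medians are at least \<open>m\<close>, and each full
      group behind them contributes three elements; so about 3/10 of all elements lie outside this
      part.\<close>
    ultimately have ls: "10 * length ?ls \<le> 7 * ?n + 30"
      using c False by linarith
    have "3 * ((c - 1) div 2 + 1) \<le> length (filter (\<lambda>x. x \<le> m) xs) + 2"
      using length_filter_le_sort_nth[OF mid, of m] medians_le[of m xs] len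
      by (simp add: m) (simp add: ms_def filter_map comp_def)
    moreover have "length (filter (\<lambda>x. x \<le> m) xs) + length ?gs = ?n"
      using sum_length_filter_compl[of "\<lambda>x. x \<le> m" xs] by (simp add: not_le)
    moreover have "c \<le> 2 * ((c - 1) div 2 + 1)"
      by presburger
    ultimately have gs: "10 * length ?gs \<le> 7 * ?n + 30"
      using c by linarith
    have sub: "length ?ls + length ?es \<le> ?n"
      using length_partition3[of m xs] by simp
    have "time (map_tm slow_median_tm (result (chop5_tm xs))) \<le> length (result (chop5_tm xs)) * (50 + 1) + 1"
      by (rule time_map_tm) (use chop5_tm_pieces time_slow_median_tm in blast)
    then have t_map: "time (map_tm slow_median_tm (result (chop5_tm xs))) \<le> 51 * c + 1"
      by (simp add: length_chop5_tm c_def)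
    define S where "S = time (select_upto_tm b ((c - 1) div 2) ms)"
    have t_m: "S \<le> 2000 * c + 10405"
      unfolding S_def using Suc.IH[OF mid] Suc.prems False by (simp add: len) (simp add: c_def)
    \<comment> \<open>The bound is 2000 * (7 n + 30) / 10 + 10405. The induction hypothesis applies
      because 7 n + 30 < 10 n for n > 100.\<close>
    have t_ls: "time (select_upto_tm b i ?ls) \<le> 1400 * ?n + 16405" if "i < length ?ls"
      using Suc.IH[OF that] ls Suc.prems False by simp
    have t_gs: "time (select_upto_tm b (i - length ?ls - length ?es) ?gs) \<le> 1400 * ?n + 16405"
      if "\<not> i < length ?ls + length ?es"
    proof -
      have "i - length ?ls - length ?es < length ?gs"
        using that length_partition3[of m xs] Suc.prems by linarith
      then show ?thesis
        using Suc.IH[of "i - length ?ls - length ?es" ?gs] gs Suc.prems False by simp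
    qed
    define R where "R = time (if i < length ?ls then select_upto_tm b i ?ls
      else if i < length ?ls + length ?es then return m
      else select_upto_tm b (i - length ?ls - length ?es) ?gs)"
    have R: "R \<le> 1400 * ?n + 16405"
      using t_ls t_gs unfolding R_def by (simp del: diff_diff_left)
    have "time (select_upto_tm (Suc b) i xs) = 1 + (?n + 1) + time (chop5_tm xs)
        + time (map_tm slow_median_tm (result (chop5_tm xs))) + (c + 1)
        + S + (?n + 1) + (length ?ls + 1) + (length ?es + 1) + R"
      using False by (simp add: ms_def length_chop5_tm m_def R_def S_def c_def del: diff_diff_left)
    also have "\<dots> \<le> 2000 * ?n + 10405"
      using time_chop5_tm[of xs] t_map t_m sub R c False by linarith
    finally show ?thesis .
  qed
qed simp

lemma time_select_tm: "i < length xs \<Longrightarrow> time (select_tm i xs) \<le> 2001 * length xs + 10407"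
  using time_select_upto_tm[of i xs "length xs"] by (simp add: select_tm_def)


section \<open>Merge sort\<close>

lemma time_split_tm: "time (split_tm xs) \<le> length xs + 1"
  by (induction xs rule: split_tm.induct) (auto simp: case_prod_beta)

lemma mset_split_tm:
  "mset (fst (result (split_tm xs))) + mset (snd (result (split_tm xs))) = mset xs"
  by (induction xs rule: split_tm.induct) (auto simp: case_prod_beta)

lemma mset_merge_tm [simp]: "mset (result (merge_tm xs ys)) = mset xs + mset ys"
  by (induction xs ys rule: merge_tm.induct) auto

lemma set_merge_tm [simp]: "set (result (merge_tm xs ys)) = set xs \<union> set ys"
  by (metis mset_merge_tm set_mset_mset set_mset_union)

lemma time_merge_tm: "time (merge_tm xs ys) \<le> length xs + length ys + 1"
  by (induction xs ys rule: merge_tm.induct) auto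

lemma sorted_merge_tm:
  "sorted (map snd xs) \<Longrightarrow> sorted (map snd ys) \<Longrightarrow> sorted (map snd (result (merge_tm xs ys)))"
  by (induction xs ys rule: merge_tm.induct) auto

text \<open>Stated by length rather than by pattern, so that the inductions below can treat
  \<open>split_tm xs\<close> as a unit and use only the lengths and the multiset of its
  halves.\<close>

lemma result_msort_tm_unfold:
  "2 \<le> length xs \<Longrightarrow> result (msort_tm xs) =
    result (merge_tm (result (msort_tm (fst (result (split_tm xs))))) (result (msort_tm (snd (result (split_tm xs))))))"
  by (cases xs rule: msort_tm.cases) (simp_all add: case_prod_beta)

lemma time_msort_tm_unfold:
  "2 \<le> length xs \<Longrightarrow> time (msort_tm xs) = 1 + time (split_tm xs)
    + time (msort_tm (fst (result (split_tm xs)))) + time (msort_tm (snd (result (split_tm xs))))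
    + time (merge_tm (result (msort_tm (fst (result (split_tm xs))))) (result (msort_tm (snd (result (split_tm xs))))))"
  by (cases xs rule: msort_tm.cases) (simp_all add: case_prod_beta)

lemma msort_tm_short: "\<not> 2 \<le> length xs \<Longrightarrow> result (msort_tm xs) = xs \<and> time (msort_tm xs) = 1"
  by (cases xs rule: msort_tm.cases) simp_all

lemma mset_msort_tm [simp]: "mset (result (msort_tm xs)) = mset xs"
proof (induction xs rule: length_induct)
  case (1 xs)
  show ?case
  proof (cases "2 \<le> length xs")
    case True
    then show ?thesis
      using 1 mset_split_tm[of xs] by (simp add: result_msort_tm_unfold length_split_tm)
  qed (simp add: msort_tm_short)
qed

lemma length_msort_tm [simp]: "length (result (msort_tm xs)) = length xs"
  by (metis mset_msort_tm size_mset)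

lemma sorted_msort_tm: "sorted (map snd (result (msort_tm xs)))"
proof (induction xs rule: length_induct)
  case (1 xs)
  show ?case
  proof (cases "2 \<le> length xs")
    case True
    then show ?thesis
      using 1 by (simp add: result_msort_tm_unfold length_split_tm sorted_merge_tm)
  next
    case False
    then show ?thesis
      by (cases xs rule: msort_tm.cases) simp_all
  qed
qed

text \<open>There are at most \<open>j\<close> levels of halving, each charged 4 steps per element.
  One call spends at most 2 n + 5 steps beyond the bounds for its halves, counted without one of
  their summands 1 twice over; n >= 2 makes this at most 4 n + 1.\<close>

lemma time_msort_tm: "length xs \<le> 2 ^ j \<Longrightarrow> time (msort_tm xs) \<le> 4 * length xs * j + 1"
proof (induction j arbitrary: xs)
  case 0
  then show ?case
    by (simp add: msort_tm_short)
next
  case (Suc j)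
  show ?case
  proof (cases "2 \<le> length xs")
    case True
    let ?ys = "fst (result (split_tm xs))" and ?zs = "snd (result (split_tm xs))"
    have len: "length ?ys + length ?zs = length xs"
      by (simp add: length_split_tm)
    have "time (msort_tm ?ys) \<le> 4 * length ?ys * j + 1" "time (msort_tm ?zs) \<le> 4 * length ?zs * j + 1"
      using Suc.prems by (intro Suc.IH; simp add: length_split_tm)+
    moreover have "4 * length ?ys * j + 4 * length ?zs * j = 4 * length xs * j"
      by (simp flip: len add: algebra_simps)
    moreover have "time (merge_tm (result (msort_tm ?ys)) (result (msort_tm ?zs))) \<le> length xs + 1"
      using time_merge_tm[of "result (msort_tm ?ys)" "result (msort_tm ?zs)"] len by simp
    ultimately have "time (msort_tm xs) \<le> 4 * length xs * j + 2 * length xs + 5"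
      using True time_split_tm[of xs] by (simp add: time_msort_tm_unfold)
    then show ?thesis
      using True by (simp add: algebra_simps)
  qed (simp add: msort_tm_short)
qed

section \<open>The greedy procedure\<close>

lemma set_dist_le_iff: "finite C \<Longrightarrow> set_dist d p C \<le> ereal r \<longleftrightarrow> (\<exists>c\<in>C. d p c \<le> r)"
  by (auto simp: set_dist_def Min_le_iff)

lemma less_set_dist_iff: "finite C \<Longrightarrow> ereal r < set_dist d p C \<longleftrightarrow> (\<forall>c\<in>C. r < d p c)"
  by (meson linorder_not_less set_dist_le_iff)

lemma set_dist_insert: "finite C \<Longrightarrow> set_dist d p (insert c C) = min (ereal (d p c)) (set_dist d p C)"
  by (auto simp: set_dist_def min_def)

lemma result_set_dist_tm [simp]: "result (set_dist_tm d p cs) = set_dist d p (set cs)"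
proof (induction cs)
  case Nil
  then show ?case
    by (simp add: set_dist_def)
qed (simp add: set_dist_insert)

lemma time_set_dist_tm [simp]: "time (set_dist_tm d p cs) = length cs + 1"
  by (induction cs) auto

section \<open>Covering and separation by the greedy centers\<close>

lemma fair_center_loop_superset: "C \<subseteq> fair_center_loop d \<alpha> \<Delta> r ps C"
proof (induction ps arbitrary: C)
  case (Cons p ps)
  show ?case
    using Cons[of "C \<union> {p}"] Cons[of C] by auto
qed simp

lemma fair_center_loop_subset: "fair_center_loop d \<alpha> \<Delta> r ps C \<subseteq> C \<union> set ps"
proof (induction ps arbitrary: C)
  case (Cons p ps)
  show ?case
    using Cons[of "C \<union> {p}"] Cons[of C] by auto
qed simp

lemma finite_fair_center_loop: "finite C \<Longrightarrow> finite (fair_center_loop d \<alpha> \<Delta> r ps C)"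
  by (rule finite_subset[OF fair_center_loop_subset]) simp

text \<open>When its turn comes, a point either becomes a center, at distance 0 from itself, or is
  skipped because a center is already close enough. Centers are never removed, so this persists to
  the end.\<close>

lemma fair_center_loop_covers:
  assumes "finite C" "\<And>p. p \<in> set ps \<Longrightarrow> d p p = 0 \<and> 0 \<le> min (\<alpha> * r p) \<Delta>" "p \<in> set ps"
  shows "\<exists>c\<in>fair_center_loop d \<alpha> \<Delta> r ps C. d p c \<le> 2 * min (\<alpha> * r p) \<Delta>"
  using assms
proof (induction ps arbitrary: C)
  case (Cons q ps)
  define C' where "C' = (if set_dist d q C > ereal (2 * min (\<alpha> * r q) \<Delta>) then C \<union> {q} else C)"
  have fin: "finite C'"
    using Cons.prems by (simp add: C'_def)
  have loop: "fair_center_loop d \<alpha> \<Delta> r (q # ps) C = fair_center_loop d \<alpha> \<Delta> r ps C'"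
    by (simp add: C'_def)
  show ?case
  proof (cases "p \<in> set ps")
    case True
    then show ?thesis
      unfolding loop using Cons.prems fin by (intro Cons.IH) auto
  next
    case False
    then have [simp]: "p = q"
      using Cons.prems by simp
    have "\<exists>c\<in>C'. d q c \<le> 2 * min (\<alpha> * r q) \<Delta>"
    proof (cases "set_dist d q C > ereal (2 * min (\<alpha> * r q) \<Delta>)")
      case True
      then show ?thesis
        using Cons.prems(2)[of q] by (auto simp: C'_def)
    next
      case False
      then have "\<exists>c\<in>C. d q c \<le> 2 * min (\<alpha> * r q) \<Delta>"
        using Cons.prems(1) by (simp add: set_dist_le_iff[symmetric] not_less)
      then show ?thesis
        using False by (simp add: C'_def)
    qed
    then show ?thesis
      unfolding loop using fair_center_loop_superset[of C' d \<alpha> \<Delta> r ps] by auto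
  qed
qed simp

text \<open>The loop tests only the radius of the point being added. The third assumption is the
  invariant that chosen centers precede the remaining points in the order, so that this radius is
  the maximum of the two. Using the maximum makes the relation symmetric, as needed when inserting
  into a \<open>pairwise\<close> set.\<close>

lemma fair_center_loop_separated:
  assumes "finite C" "sorted (map r ps)" "\<And>c p. c \<in> C \<Longrightarrow> p \<in> set ps \<Longrightarrow> r c \<le> r p"
    "\<And>p q. d p q = d q p"
    "pairwise (\<lambda>p q. 2 * min (\<alpha> * max (r p) (r q)) \<Delta> < d p q) C"
  shows "pairwise (\<lambda>p q. 2 * min (\<alpha> * max (r p) (r q)) \<Delta> < d p q) (fair_center_loop d \<alpha> \<Delta> r ps C)"
  using assms
proof (induction ps arbitrary: C)
  case (Cons p ps)
  show ?case
  proof (cases "set_dist d p C > ereal (2 * min (\<alpha> * r p) \<Delta>)")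
    case True
    then have far: "2 * min (\<alpha> * r p) \<Delta> < d p c" if "c \<in> C" for c
      using that Cons.prems(1) by (simp add: less_set_dist_iff)
    have "pairwise (\<lambda>p q. 2 * min (\<alpha> * max (r p) (r q)) \<Delta> < d p q) (insert p C)"
    proof -
      have "2 * min (\<alpha> * max (r p) (r c)) \<Delta> < d p c \<and> 2 * min (\<alpha> * max (r c) (r p)) \<Delta> < d c p"
        if "c \<in> C" for c
        using far[OF that] Cons.prems(3)[OF that, of p] Cons.prems(4)[of c p]
        by (simp add: max_absorb1 max_absorb2)
      then show ?thesis
        unfolding pairwise_insert using Cons.prems(5) by blast
    qed
    then have "pairwise (\<lambda>p q. 2 * min (\<alpha> * max (r p) (r q)) \<Delta> < d p q)
        (fair_center_loop d \<alpha> \<Delta> r ps (insert p C))"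
      by (intro Cons.IH Cons.prems(4)) (use Cons.prems(1-3) in auto)
    then show ?thesis
      using True by simp
  next
    case False
    have "pairwise (\<lambda>p q. 2 * min (\<alpha> * max (r p) (r q)) \<Delta> < d p q) (fair_center_loop d \<alpha> \<Delta> r ps C)"
      by (intro Cons.IH Cons.prems(4,5)) (use Cons.prems(1-3) in auto)
    then show ?thesis
      using False by simp
  qed
qed simp

text \<open>Two centers sharing a nearest point of \<open>C'\<close> would violate the separation, since the
  radius bound of the later one dominates.\<close>

lemma (in Metric_space) card_fair_center_le:
  assumes "sorted (map r ps)" "set ps \<subseteq> M" "0 \<le> \<alpha>" "finite C'" "C' \<subseteq> M"
    and near: "\<And>p. p \<in> set ps \<Longrightarrow> \<exists>c\<in>C'. d p c \<le> min (\<alpha> * r p) \<Delta>"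
  shows "card (fair_center d \<alpha> \<Delta> r ps) \<le> card C'"
proof -
  let ?C = "fair_center d \<alpha> \<Delta> r ps"
  have sub: "?C \<subseteq> set ps"
    using fair_center_loop_subset[of d \<alpha> \<Delta> r ps "{}"] by (simp add: fair_center_def)
  have sep: "pairwise (\<lambda>p q. 2 * min (\<alpha> * max (r p) (r q)) \<Delta> < d p q) ?C"
    unfolding fair_center_def by (rule fair_center_loop_separated) (use assms commute in auto)
  obtain f where f: "\<And>p. p \<in> set ps \<Longrightarrow> f p \<in> C' \<and> d p (f p) \<le> min (\<alpha> * r p) \<Delta>"
    using near by metis
  have "inj_on f ?C"
  proof (rule inj_onI, rule ccontr)
    fix p q
    assume pq: "p \<in> ?C" "q \<in> ?C" "f p = f q" "p \<noteq> q"
    have ps: "p \<in> set ps" "q \<in> set ps"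
      using pq sub by auto
    have "\<alpha> * r p \<le> \<alpha> * max (r p) (r q)" "\<alpha> * r q \<le> \<alpha> * max (r p) (r q)"
      using \<open>0 \<le> \<alpha>\<close> by (auto intro: mult_left_mono)
    then have "d p (f p) + d (f p) q \<le> 2 * min (\<alpha> * max (r p) (r q)) \<Delta>"
      using f[OF ps(1)] f[OF ps(2)] pq commute[of q "f q"] by (auto simp: min_def split: if_splits)
    moreover have "d p q \<le> d p (f p) + d (f p) q"
      using ps f assms by (intro triangle) auto
    moreover have "2 * min (\<alpha> * max (r p) (r q)) \<Delta> < d p q"
      using sep pq by (auto simp: pairwise_def)
    ultimately show False
      by linarith
  qed
  then show ?thesis
    by (rule card_inj_on_le) (use f sub \<open>finite C'\<close> in auto)
qed

text \<open>Stopping early is sound because centers are never removed: k centers together with the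
  next one already exceed k, and all of them would be in the final set. Distinctness and
  disjointness make the length of the list the cardinality of the set of centers.\<close>

lemma result_fair_center_loop_tm:
  assumes "distinct ps" "distinct C" "set ps \<inter> set C = {}" "length C \<le> k"
  shows "case result (fair_center_loop_tm d k \<alpha> \<Delta> (map (\<lambda>p. (p, r p)) ps) (length C) C) of
      None \<Rightarrow> k < card (fair_center_loop d \<alpha> \<Delta> r ps (set C))
    | Some L \<Rightarrow> set L = fair_center_loop d \<alpha> \<Delta> r ps (set C)
        \<and> card (fair_center_loop d \<alpha> \<Delta> r ps (set C)) \<le> k"
  using assms
proof (induction ps arbitrary: C)
  case Nil
  then show ?case
    by (simp add: distinct_card)
next
  case (Cons p ps)
  show ?case
  proof (cases "set_dist d p (set C) > ereal (2 * min (\<alpha> * r p) \<Delta>)")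
    case True
    show ?thesis
    proof (cases "length C = k")
      case full: True
      have "card (insert p (set C)) \<le> card (fair_center_loop d \<alpha> \<Delta> r ps (insert p (set C)))"
        by (intro card_mono finite_fair_center_loop fair_center_loop_superset) simp
      moreover have "card (insert p (set C)) = Suc k"
        using Cons.prems full by (simp add: distinct_card)
      ultimately show ?thesis
        using True full by simp
    next
      case False
      then show ?thesis
        using True Cons.prems Cons.IH[of "p # C"] by (simp cong del: option.case_cong_weak)
    qed
  next
    case False
    then show ?thesis
      using Cons.prems Cons.IH[of C] by (simp cong del: option.case_cong_weak)
  qed
qed

text \<open>At most \<open>min k n\<close> centers are ever scanned for one point. Besides k, the
  bound n is kept so that the product with the number of points stays at most n^2 when k exceeds
  n.\<close>

lemma time_fair_center_loop_tm:
  "length C + length prs \<le> n \<Longrightarrow> length C \<le> k \<Longrightarrow>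
    time (fair_center_loop_tm d k \<alpha> \<Delta> prs (length C) C) \<le> length prs * (min k n + 2) + 1"
proof (induction prs arbitrary: C)
  case (Cons pr prs)
  define m where "m = min k n"
  note IH = Cons.IH[folded m_def]
  have C: "length C \<le> m"
    using Cons.prems by (simp add: m_def)
  show ?case
  proof (cases "set_dist d (fst pr) (set C) > ereal (2 * min (\<alpha> * snd pr) \<Delta>)")
    case True
    show ?thesis
    proof (cases "length C = k")
      case False
      then have "time (fair_center_loop_tm d k \<alpha> \<Delta> prs (length C + 1) (fst pr # C)) \<le> length prs * (m + 2) + 1"
        using IH[of "fst pr # C"] Cons.prems by simp
      then show ?thesis
        unfolding m_def[symmetric] using True False C by simp
    next
      case full: True
      then show ?thesis
        unfolding m_def[symmetric] using True C by simp
    qed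
  next
    case False
    then have "time (fair_center_loop_tm d k \<alpha> \<Delta> prs (length C) C) \<le> length prs * (m + 2) + 1"
      using IH[of C] Cons.prems by simp
    then show ?thesis
      unfolding m_def[symmetric] using False C by simp
  qed
qed simp

text \<open>Sorting does not involve \<Delta>, so one ordering \<open>qs\<close> serves all
  candidate values; it is whatever order merge sort produces, however ties are broken.\<close>

lemma result_fair_center_tm:
  assumes "distinct ps"
  obtains qs where "distinct qs" "set qs = set ps" "sorted (map r qs)"
    "\<forall>\<Delta>. case result (fair_center_tm d k \<alpha> \<Delta> (map (\<lambda>p. (p, r p)) ps)) of
        None \<Rightarrow> k < card (fair_center d \<alpha> \<Delta> r qs)
      | Some L \<Rightarrow> set L = fair_center d \<alpha> \<Delta> r qs \<and> card (fair_center d \<alpha> \<Delta> r qs) \<le> k"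
proof
  define prs where "prs = result (msort_tm (map (\<lambda>p. (p, r p)) ps))"
  define qs where "qs = map fst prs"
  have mset: "mset prs = mset (map (\<lambda>p. (p, r p)) ps)"
    by (simp add: prs_def)
  then have "set prs = (\<lambda>p. (p, r p)) ` set ps"
    by (metis list.set_map set_mset_mset)
  \<comment> \<open>The second component of every pair is determined by the first, so the sorted
    pairs can be rebuilt from the points alone.\<close>
  then have prs: "prs = map (\<lambda>p. (p, r p)) qs"
    unfolding qs_def map_map by (intro map_idI[symmetric]) auto
  have "mset qs = image_mset fst (mset (map (\<lambda>p. (p, r p)) ps))"
    by (simp add: qs_def mset)
  then have mset_qs: "mset qs = mset ps"
    by (simp add: multiset.map_comp comp_def)
  then show qs: "distinct qs" "set qs = set ps"
    using assms mset_eq_imp_distinct_iff mset_eq_setD by blast+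
  have "map r qs = map snd prs"
    by (simp add: prs)
  then show "sorted (map r qs)"
    by (simp add: prs_def sorted_msort_tm)
  show "\<forall>\<Delta>. case result (fair_center_tm d k \<alpha> \<Delta> (map (\<lambda>p. (p, r p)) ps)) of
        None \<Rightarrow> k < card (fair_center d \<alpha> \<Delta> r qs)
      | Some L \<Rightarrow> set L = fair_center d \<alpha> \<Delta> r qs \<and> card (fair_center d \<alpha> \<Delta> r qs) \<le> k"
    using result_fair_center_loop_tm[of qs "[]" k d \<alpha> _ r] qs(1) prs
    by (simp add: fair_center_tm_def fair_center_def prs_def cong del: option.case_cong_weak)
qed

lemma time_fair_center_tm:
  assumes "length prs \<le> 2 ^ j"
  shows "time (fair_center_tm d k \<alpha> \<Delta> prs) \<le>
    4 * length prs * j + length prs * (min k (length prs) + 2) + 3"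
  using time_msort_tm[OF assms]
    time_fair_center_loop_tm[of "[]" "result (msort_tm prs)" "length prs" k d \<alpha> \<Delta>]
  by (simp add: fair_center_tm_def)


section \<open>Fair radii and the optimal cost\<close>

lemma ceiling_div_le_iff:
  fixes n k m :: nat
  assumes "0 < k"
  shows "(n + k - 1) div k \<le> m \<longleftrightarrow> real n / real k \<le> real m"
proof -
  have "(n + k - 1) div k \<le> m \<longleftrightarrow> n + k - 1 < (m + 1) * k"
    using assms by (metis Suc_eq_plus1 div_less_iff_less_mult less_Suc_eq_le)
  also have "\<dots> \<longleftrightarrow> n \<le> m * k"
    using assms by auto
  also have "\<dots> \<longleftrightarrow> real n \<le> real m * real k"
    by (metis of_nat_le_iff of_nat_mult)
  also have "\<dots> \<longleftrightarrow> real n / real k \<le> real m"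
    using assms by (simp add: pos_divide_le_eq)
  finally show ?thesis .
qed

lemma fair_index_less:
  fixes n k :: nat
  assumes "0 < k" "0 < n"
  shows "(n + k - 1) div k - 1 < n"
proof -
  have "real n / real k \<le> real n"
    using assms by (simp add: divide_le_eq)
  then have "(n + k - 1) div k \<le> n"
    using ceiling_div_le_iff[OF assms(1)] by simp
  then show ?thesis
    using assms by linarith
qed

text \<open>The ball around \<open>p\<close> becomes large enough exactly when r reaches the
  (n/k)-th smallest distance, rounded up. The infimum is therefore taken over a closed ray and
  equals its left end. Since \<open>ps\<close> is distinct, ball sizes are counts of list
  entries.\<close>

lemma fair_radius_eq:
  assumes "\<And>p q. 0 \<le> d p q" "distinct ps" "ps \<noteq> []" "0 < k"
  shows "fair_radius (set ps) d k p = sort (map (d p) ps) ! ((length ps + k - 1) div k - 1)"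
proof -
  let ?n = "length ps"
  let ?i = "(?n + k - 1) div k - 1"
  let ?s = "sort (map (d p) ps) ! ?i"
  have i: "?i < length (map (d p) ps)"
    using assms fair_index_less by simp
  \<comment> \<open>Positivity keeps the shift to indices from 0 from being truncated.\<close>
  have pos: "0 < (?n + k - 1) div k"
    using assms by (cases ps) (auto simp: div_greater_zero_iff)
  have "?s \<in> set (sort (map (d p) ps))"
    using i by (intro nth_mem) simp
  then have s: "0 \<le> ?s"
    using assms(1) by auto
  have "real (card (set ps)) / real k \<le> real (card (pball (set ps) d p r)) \<longleftrightarrow> ?s \<le> r" for r
  proof -
    have "pball (set ps) d p r = set (filter (\<lambda>q. d p q \<le> r) ps)"
      by (auto simp: pball_def)
    then have "card (pball (set ps) d p r) = length (filter (\<lambda>q. d p q \<le> r) ps)"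
      using distinct_card[OF distinct_filter[OF assms(2)]] by metis
    then have card: "card (pball (set ps) d p r) = length (filter (\<lambda>x. x \<le> r) (map (d p) ps))"
      by (simp add: filter_map comp_def)
    have "real (card (set ps)) / real k \<le> real (card (pball (set ps) d p r)) \<longleftrightarrow>
        (?n + k - 1) div k \<le> card (pball (set ps) d p r)"
      unfolding ceiling_div_le_iff[OF assms(4)] distinct_card[OF assms(2)] ..
    also have "\<dots> \<longleftrightarrow> ?i < card (pball (set ps) d p r)"
      using pos by linarith
    also have "\<dots> \<longleftrightarrow> ?s \<le> r"
      unfolding card sort_nth_le_iff[OF i] ..
    finally show ?thesis .
  qed
  then have "{r. 0 \<le> r \<and> real (card (set ps)) / real k \<le> real (card (pball (set ps) d p r))} = {r. 0 \<le> r \<and> ?s \<le> r}"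
    by blast
  also have "\<dots> = {?s..}"
    using s by (blast intro: order_trans)
  finally show ?thesis
    unfolding fair_radius_def by (simp only: cInf_atLeast)
qed

lemma cost_le_iff: "finite P \<Longrightarrow> P \<noteq> {} \<Longrightarrow> cost P d C \<le> x \<longleftrightarrow> (\<forall>p\<in>P. set_dist d p C \<le> x)"
  by (simp add: cost_def)

text \<open>The empty set has distance \<infinity> to every point, while the fairness bounds are
  finite. Hence there is a center, and k is positive.\<close>

lemma feasible_nonempty:
  assumes "finite P" "P \<noteq> {}" "feasible P d \<alpha> k C"
  shows "finite C" "C \<subseteq> P" "C \<noteq> {}" "0 < k"
proof -
  show *: "C \<subseteq> P" "finite C"
    using assms finite_subset by (auto simp: feasible_def fair_def)
  show "C \<noteq> {}"
    using assms by (auto simp: feasible_def fair_def set_dist_def)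
  then show "0 < k"
    using assms * by (auto simp: feasible_def card_gt_0_iff)
qed

text \<open>Only finitely many subsets compete, so the minimum is attained; its value is a maximum
  of minima of distances, hence itself a distance. This puts the optimal cost among the candidates
  of the search.\<close>

lemma opt_cost_attained:
  assumes "finite P" "P \<noteq> {}" "\<exists>C. feasible P d \<alpha> k C"
  obtains C D where "feasible P d \<alpha> k C" "cost P d C = ereal D" "opt_cost P d \<alpha> k = ereal D"
    "D \<in> pairwise_dists P d"
proof -
  let ?F = "{C. feasible P d \<alpha> k C}"
  have "?F \<subseteq> Pow P"
    by (auto simp: feasible_def fair_def)
  then have "finite ?F"
    using assms(1) finite_subset by blast
  then have "opt_cost P d \<alpha> k \<in> cost P d ` ?F"
    unfolding opt_cost_def using assms(3) by (intro Min_in) auto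
  then obtain C where C: "feasible P d \<alpha> k C" "opt_cost P d \<alpha> k = cost P d C"
    by auto
  have "cost P d C \<in> (\<lambda>p. set_dist d p C) ` P"
    unfolding cost_def using assms by (intro Max_in) auto
  then obtain p where p: "p \<in> P" "cost P d C = set_dist d p C"
    by auto
  note fin = feasible_nonempty[OF assms(1,2) C(1)]
  have "(MIN c\<in>C. d p c) \<in> d p ` C"
    using fin by (intro Min_in) auto
  then obtain c where "c \<in> C" "(MIN c\<in>C. d p c) = d p c"
    by auto
  then have "(MIN c\<in>C. d p c) \<in> pairwise_dists P d"
    using p fin unfolding pairwise_dists_def by blast
  with C p fin that show ?thesis
    by (simp add: set_dist_def)
qed

lemma (in Metric_space) fair_radius_nonneg:
  assumes "finite M" "M \<noteq> {}" "0 < k"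
  shows "0 \<le> fair_radius M d k p"
proof -
  obtain ps where ps: "set ps = M" "distinct ps"
    using assms(1) finite_distinct_list by blast
  have "ps \<noteq> []"
    using ps(1) assms(2) by auto
  then have eq: "fair_radius M d k p = sort (map (d p) ps) ! ((length ps + k - 1) div k - 1)"
    unfolding ps(1)[symmetric] using ps(2) assms(3) nonneg by (intro fair_radius_eq)
  have "fair_radius M d k p \<in> set (sort (map (d p) ps))"
    unfolding eq using fair_index_less[OF assms(3), of "length ps"] \<open>ps \<noteq> []\<close>
    by (intro nth_mem) simp
  then show ?thesis
    by auto
qed

text \<open>The covering radius \<open>2 * min (\<alpha> * r p) \<Delta>\<close> yields both factors
  2 at once: its second argument bounds the cost, its first the fairness.\<close>

lemma (in Metric_space) approximation_fair_center:
  assumes "finite M" "M \<noteq> {}" "0 < k" "0 < \<alpha>" "set ps = M" "0 \<le> \<Delta>"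
    and "card (fair_center d \<alpha> \<Delta> (fair_radius M d k) ps) \<le> k" "ereal \<Delta> \<le> opt_cost M d \<alpha> k"
  shows "approximation 2 2 M d \<alpha> k (fair_center d \<alpha> \<Delta> (fair_radius M d k) ps)"
proof -
  let ?r = "fair_radius M d k"
  let ?C = "fair_center d \<alpha> \<Delta> ?r ps"
  have sub: "?C \<subseteq> M"
    using fair_center_loop_subset[of d \<alpha> \<Delta> ?r ps "{}"] assms by (simp add: fair_center_def)
  have fin: "finite ?C"
    using sub assms finite_subset by blast
  have cover: "\<exists>c\<in>?C. d p c \<le> 2 * min (\<alpha> * ?r p) \<Delta>" if "p \<in> M" for p
    unfolding fair_center_def
    by (rule fair_center_loop_covers) (use that assms fair_radius_nonneg in auto)
  have *: "set_dist d p ?C \<le> ereal (2 * \<Delta>) \<and> set_dist d p ?C \<le> ereal (2 * \<alpha> * ?r p)" if p: "p \<in> M" for p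
  proof -
    obtain c where c: "c \<in> ?C" "d p c \<le> 2 * min (\<alpha> * ?r p) \<Delta>"
      using cover[OF p] by blast
    then have "d p c \<le> 2 * \<Delta>" "d p c \<le> 2 * \<alpha> * ?r p"
      by linarith+
    then show ?thesis
      unfolding set_dist_le_iff[OF fin] using c(1) by blast
  qed
  have "ereal (2 * \<Delta>) \<le> ereal 2 * opt_cost M d \<alpha> k"
    using assms(8) ereal_mult_left_mono[of "ereal \<Delta>" "opt_cost M d \<alpha> k" "ereal 2"] by simp
  then have "cost M d ?C \<le> ereal 2 * opt_cost M d \<alpha> k"
    unfolding cost_le_iff[OF assms(1,2)] using * order_trans by blast
  then show ?thesis
    using * sub assms(7) by (simp add: approximation_def fair_def)
qed

text \<open>A feasible set of cost at most \<Delta> meets both bounds in the minimum, so it can take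
  the role of \<open>C'\<close> in \<open>card_fair_center_le\<close>. Read contrapositively with an
  optimal \<open>C\<close>, candidates that fail lie below the optimal cost.\<close>

lemma (in Metric_space) card_fair_center_le_k:
  assumes "finite M" "M \<noteq> {}" "feasible M d \<alpha> k C" "cost M d C \<le> ereal \<Delta>" "0 < \<alpha>"
    and "set ps = M" "sorted (map (fair_radius M d k) ps)"
  shows "card (fair_center d \<alpha> \<Delta> (fair_radius M d k) ps) \<le> k"
proof -
  note C = feasible_nonempty[OF assms(1-3)]
  have "card (fair_center d \<alpha> \<Delta> (fair_radius M d k) ps) \<le> card C"
  proof (rule card_fair_center_le)
    fix p
    assume "p \<in> set ps"
    then have "set_dist d p C \<le> ereal (min (\<alpha> * fair_radius M d k p) \<Delta>)"
      using assms by (auto simp: cost_le_iff feasible_def fair_def min_def)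
    then show "\<exists>c\<in>C. d p c \<le> min (\<alpha> * fair_radius M d k p) \<Delta>"
      unfolding set_dist_le_iff[OF C(1)] .
  qed (use assms C in auto)
  also have "card C \<le> k"
    using assms by (simp add: feasible_def)
  finally show ?thesis .
qed


section \<open>Binary search\<close>

text \<open>The number of centers need not be monotone in the candidate value, but only candidates below
  \<open>\<delta>\<close> fail. Hence either \<open>\<delta>\<close> remains among the candidates, or the search has succeeded
  with a value at most \<open>\<delta>\<close> and only considers such values from then on.\<close>

lemma result_search_tm:
  assumes "\<And>\<Delta>. result (fair_center_tm d k \<alpha> \<Delta> prs) = None \<Longrightarrow> \<Delta> < \<delta>"
    and "\<And>\<Delta> L. \<Delta> \<in> A \<Longrightarrow> \<Delta> \<le> \<delta> \<Longrightarrow> result (fair_center_tm d k \<alpha> \<Delta> prs) = Some L \<Longrightarrow> Q L"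
    and "length D \<le> b" "set D \<subseteq> A"
    and "\<delta> \<in> set D \<or> (\<exists>L. best = Some L \<and> Q L) \<and> (\<forall>x\<in>set D. x \<le> \<delta>)"
  shows "\<exists>L. result (search_tm b d k \<alpha> prs D best) = Some L \<and> Q L"
  using assms(3-5)
proof (induction b arbitrary: D best)
  case (Suc b)
  show ?case
  proof (cases "D = []")
    case False
    let ?i = "(length D - 1) div 2"
    define \<Delta> where "\<Delta> = sort D ! ?i"
    have i: "?i < length D"
      using False by (rule median_index_less)
    have "\<Delta> \<in> set (sort D)"
      unfolding \<Delta>_def using i by (intro nth_mem) simp
    then have \<Delta>: "\<Delta> \<in> set D"
      by simp
    have len: "length (filter (\<lambda>x. x < \<Delta>) D) \<le> b" "length (filter (\<lambda>x. \<Delta> < x) D) \<le> b"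
      using length_filter_less_sort_nth[OF i] Suc.prems i unfolding \<Delta>_def by linarith+
    have step: "result (search_tm (Suc b) d k \<alpha> prs D best) =
      (case result (fair_center_tm d k \<alpha> \<Delta> prs) of
         None \<Rightarrow> result (search_tm b d k \<alpha> prs (filter (\<lambda>x. \<Delta> < x) D) best)
       | Some C \<Rightarrow> result (search_tm b d k \<alpha> prs (filter (\<lambda>x. x < \<Delta>) D) (Some C)))"
      using False i by (simp add: \<Delta>_def split: option.split)
    show ?thesis
    proof (cases "result (fair_center_tm d k \<alpha> \<Delta> prs)")
      case None
      have "\<Delta> < \<delta>"
        using assms(1)[OF None] .
      \<comment> \<open>If \<delta> was a candidate, it survives among the larger ones; otherwise
        \<open>best\<close> stays valid and the candidates only become fewer.\<close>
      then show ?thesis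
        unfolding step using None len Suc.prems by (auto intro!: Suc.IH)
    next
      case (Some C)
      have "Q C" if "\<Delta> \<le> \<delta>"
        using assms(2)[OF _ that Some] \<Delta> Suc.prems by auto
      \<comment> \<open>If \<Delta> <= \<delta>, then \<open>C\<close> is a valid result and all
        remaining candidates are below \<delta>. If \<Delta> > \<delta>, then \<Delta> itself
        refutes the second alternative, so \<delta> is a candidate and survives among the smaller
        ones.\<close>
      then show ?thesis
        unfolding step using Some len Suc.prems \<Delta>
        by (cases "\<Delta> \<le> \<delta>") (auto intro!: Suc.IH)
    qed
  qed (use Suc.prems in simp)
qed simp

text \<open>At most \<open>j\<close> rounds take place, as each halves the list. A round costs about
  2003 steps per candidate; summed over the halvings this at most doubles, whence 4010. The fixed
  costs of a round and its greedy run are within F + 15000.\<close>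

lemma time_search_tm:
  assumes F: "\<And>\<Delta>. time (fair_center_tm d k \<alpha> \<Delta> prs) \<le> F"
  shows "length D < 2 ^ j \<Longrightarrow> length D \<le> b \<Longrightarrow>
    time (search_tm b d k \<alpha> prs D best) \<le> 4010 * length D + (F + 15000) * j + 1"
proof (induction b arbitrary: D best j)
  case (Suc b)
  show ?case
  proof (cases "D = []")
    case False
    let ?i = "(length D - 1) div 2"
    define \<Delta> where "\<Delta> = sort D ! ?i"
    have i: "?i < length D"
      using False by (rule median_index_less)
    obtain j' where j: "j = Suc j'"
      using Suc.prems False by (cases j) auto
    let ?ls = "filter (\<lambda>x. x < \<Delta>) D" and ?gs = "filter (\<lambda>x. \<Delta> < x) D"
    have half: "length ?ls \<le> length D div 2" "length ?gs \<le> length D div 2"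
      using length_filter_less_sort_nth[OF i] i unfolding \<Delta>_def by linarith+
    have rec: "time (search_tm b d k \<alpha> prs xs best') \<le> 2005 * length D + (F + 15000) * j' + 1"
      if "length xs \<le> length D div 2" for xs best'
    proof -
      have "length xs < 2 ^ j'" "length xs \<le> b"
        using that Suc.prems j False by auto
      then have "time (search_tm b d k \<alpha> prs xs best') \<le> 4010 * length xs + (F + 15000) * j' + 1"
        by (rule Suc.IH)
      then show ?thesis
        using that by linarith
    qed
    define R where "R = time (case result (fair_center_tm d k \<alpha> \<Delta> prs) of
         None \<Rightarrow> search_tm b d k \<alpha> prs ?gs best
       | Some C \<Rightarrow> search_tm b d k \<alpha> prs ?ls (Some C))"
    have R: "R \<le> 2005 * length D + (F + 15000) * j' + 1"
      unfolding R_def using rec half by (auto split: option.split)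
    have "time (search_tm (Suc b) d k \<alpha> prs D best) = 1 + (length D + 1) + time (select_tm ?i D)
        + (length D + 1) + time (fair_center_tm d k \<alpha> \<Delta> prs) + R"
      using False i by (simp add: \<Delta>_def R_def cong del: option.case_cong_weak)
    also have "\<dots> \<le> 4010 * length D + (F + 15000) * j' + 1 + (F + 15000)"
      using R F[of \<Delta>] time_select_tm[OF i] by linarith
    also have "\<dots> = 4010 * length D + (F + 15000) * j + 1"
      by (simp add: j)
    finally show ?thesis .
  qed simp
qed simp


section \<open>The algorithm\<close>

lemma set_pairwise_dists_tm: "set (result (pairwise_dists_tm d ps qs)) = (\<Union>p\<in>set ps. d p ` set qs)"
  by (induction ps) auto

lemma length_pairwise_dists_tm [simp]: "length (result (pairwise_dists_tm d ps qs)) = length ps * length qs"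
  by (induction ps) auto

lemma time_pairwise_dists_tm: "time (pairwise_dists_tm d ps qs) \<le> length ps * (2 * length qs + 3) + 1"
proof (induction ps)
  case (Cons p ps)
  have "time (map_tm (\<lambda>q. return (d p q)) qs) \<le> length qs * (0 + 1) + 1"
    by (rule time_map_tm) simp
  then show ?case
    using Cons by simp
qed simp

lemma time_fair_radius_tm:
  assumes "0 < k" "ps \<noteq> []"
  shows "time (fair_radius_tm d k ps (length ps) p) \<le> 2002 * length ps + 10409"
proof -
  have "time (map_tm (\<lambda>q. return (d p q)) ps) \<le> length ps * (0 + 1) + 1"
    by (rule time_map_tm) simp
  moreover have "time (select_tm ((length ps + k - 1) div k - 1) (map (d p) ps)) \<le> 2001 * length ps + 10407"
    using time_select_tm[of "(length ps + k - 1) div k - 1" "map (d p) ps"] fair_index_less[of k "length ps"] assms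
    by simp
  ultimately show ?thesis
    by (simp add: fair_radius_tm_def)
qed

lemma result_fair_radius_tm:
  assumes "\<And>p q. 0 \<le> d p q" "distinct ps" "ps \<noteq> []" "0 < k"
  shows "result (fair_radius_tm d k ps (length ps) p) = fair_radius (set ps) d k p"
  unfolding fair_radius_eq[OF assms]
  using fair_index_less[of k "length ps"] assms(3,4) by (simp add: fair_radius_tm_def)

lemma result_approx_fair_center_tm:
  assumes "\<And>p q. 0 \<le> d p q" "distinct ps" "ps \<noteq> []" "0 < k"
  shows "result (approx_fair_center_tm d k \<alpha> ps) =
    result (search_tm (length ps * length ps) d k \<alpha> (map (\<lambda>p. (p, fair_radius (set ps) d k p)) ps)
      (result (pairwise_dists_tm d ps ps)) None)"
  by (simp add: approx_fair_center_tm_def result_fair_radius_tm[OF assms])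

lemma (in Metric_space) approximation_approx_fair_center_tm:
  assumes "finite M" "M \<noteq> {}" "0 < \<alpha>" "\<exists>C. feasible M d \<alpha> k C" "distinct ps" "set ps = M"
  shows "\<exists>C. result (approx_fair_center_tm d k \<alpha> ps) = Some C \<and> approximation 2 2 M d \<alpha> k (set C)"
proof -
  let ?r = "fair_radius M d k"
  obtain C \<delta> where C: "feasible M d \<alpha> k C" "cost M d C = ereal \<delta>" "opt_cost M d \<alpha> k = ereal \<delta>"
    "\<delta> \<in> pairwise_dists M d"
    using opt_cost_attained[OF assms(1,2,4)] by blast
  have k: "0 < k"
    using feasible_nonempty[OF assms(1,2) C(1)] by simp
  obtain qs where "distinct qs" and set_qs: "set qs = set ps" and sorted: "sorted (map ?r qs)"
    and fc: "\<forall>\<Delta>. case result (fair_center_tm d k \<alpha> \<Delta> (map (\<lambda>p. (p, ?r p)) ps)) of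
        None \<Rightarrow> k < card (fair_center d \<alpha> \<Delta> ?r qs)
      | Some L \<Rightarrow> set L = fair_center d \<alpha> \<Delta> ?r qs \<and> card (fair_center d \<alpha> \<Delta> ?r qs) \<le> k"
    by (rule result_fair_center_tm[OF assms(5), where r = ?r and d = d and k = k and \<alpha> = \<alpha>])
  note qs = set_qs[unfolded assms(6)] sorted
  have D: "set (result (pairwise_dists_tm d ps ps)) = pairwise_dists M d"
    using assms(6) by (auto simp: set_pairwise_dists_tm pairwise_dists_def)
  have "\<exists>L. result (search_tm (length ps * length ps) d k \<alpha> (map (\<lambda>p. (p, ?r p)) ps)
      (result (pairwise_dists_tm d ps ps)) None) = Some L \<and> approximation 2 2 M d \<alpha> k (set L)"
  proof (rule result_search_tm[where A = "pairwise_dists M d" and \<delta> = \<delta>])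
    fix \<Delta>
    assume "result (fair_center_tm d k \<alpha> \<Delta> (map (\<lambda>p. (p, ?r p)) ps)) = None"
    then have "k < card (fair_center d \<alpha> \<Delta> ?r qs)"
      using fc[rule_format, of \<Delta>] by simp
    then show "\<Delta> < \<delta>"
      using card_fair_center_le_k[OF assms(1,2) C(1) _ assms(3) qs, of \<Delta>] C(2) by fastforce
  next
    fix \<Delta> L
    assume *: "\<Delta> \<in> pairwise_dists M d" "\<Delta> \<le> \<delta>"
      "result (fair_center_tm d k \<alpha> \<Delta> (map (\<lambda>p. (p, ?r p)) ps)) = Some L"
    have "0 \<le> \<Delta>"
      using *(1) by (auto simp: pairwise_dists_def)
    then show "approximation 2 2 M d \<alpha> k (set L)"
      using approximation_fair_center[OF assms(1,2) k assms(3) qs(1), of \<Delta>] fc[rule_format, of \<Delta>] * C by simp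
  qed (use C D in auto)
  then show ?thesis
    using result_approx_fair_center_tm[of d ps k \<alpha>] assms k by auto
qed

text \<open>The optimal cost is a successful candidate, so the smallest successful one does not
  exceed it.\<close>

lemma (in Metric_space) approximation_approx_fair_center:
  assumes "finite M" "M \<noteq> {}" "0 < \<alpha>" "\<exists>C. feasible M d \<alpha> k C" "set ps = M"
    and "sorted (map (fair_radius M d k) ps)"
  shows "\<exists>C. approx_fair_center d k \<alpha> ps = Some C \<and> approximation 2 2 M d \<alpha> k C"
proof -
  let ?r = "fair_radius M d k"
  define S where "S = {\<Delta> \<in> pairwise_dists M d. card (fair_center d \<alpha> \<Delta> ?r ps) \<le> k}"
  obtain C \<delta> where C: "feasible M d \<alpha> k C" "cost M d C = ereal \<delta>" "opt_cost M d \<alpha> k = ereal \<delta>"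
    "\<delta> \<in> pairwise_dists M d"
    using opt_cost_attained[OF assms(1,2,4)] by blast
  have k: "0 < k"
    using feasible_nonempty[OF assms(1,2) C(1)] by simp
  have "pairwise_dists M d = (\<lambda>(p, q). d p q) ` (M \<times> M)"
    by (auto simp: pairwise_dists_def)
  then have fin: "finite S"
    using assms(1) by (simp add: S_def)
  have \<delta>: "\<delta> \<in> S"
    using C card_fair_center_le_k[OF assms(1,2) C(1) _ assms(3,5,6), of \<delta>] by (simp add: S_def)
  have "Min S \<in> S"
    using fin \<delta> by (intro Min_in) auto
  then have *: "0 \<le> Min S" "card (fair_center d \<alpha> (Min S) ?r ps) \<le> k"
    by (auto simp: S_def pairwise_dists_def)
  have "approximation 2 2 M d \<alpha> k (fair_center d \<alpha> (Min S) ?r ps)"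
    by (rule approximation_fair_center) (use assms k * C fin \<delta> in auto)
  moreover have "approx_fair_center d k \<alpha> ps = Some (fair_center d \<alpha> (Min S) ?r ps)"
    using \<delta> assms(5) by (auto simp: approx_fair_center_def Let_def S_def)
  ultimately show ?thesis
    by simp
qed


section \<open>Running time\<close>

text \<open>Used with 2^j proportional to n, to absorb n log^2 n into n^2. The factor 2 is needed at
  j = 3.\<close>

lemma square_le_two_power: "j\<^sup>2 \<le> 2 * 2 ^ j" for j :: nat
proof (induction j)
  case (Suc j)
  show ?case
  proof (cases "j < 3")
    case True
    then consider "j = 0" | "j = 1" | "j = 2"
      by linarith
    then show ?thesis
      by cases (auto simp: power2_eq_square)
  next
    case False
    then have "3 * j \<le> j * j"
      by simp
    moreover have "(Suc j)\<^sup>2 = j * j + 2 * j + 1"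
      by (simp add: power2_eq_square)
    ultimately have "(Suc j)\<^sup>2 \<le> 2 * j\<^sup>2"
      using False unfolding power2_eq_square[of j] by linarith
    then show ?thesis
      using Suc by simp
  qed
qed simp

lemma time_approx_fair_center_tm:
  assumes "0 < k" "ps \<noteq> []" "length ps < 2 ^ j" "2 ^ j \<le> 2 * length ps"
  shows "time (approx_fair_center_tm d k \<alpha> ps) \<le>
    100000 * (length ps)\<^sup>2 + 2 * (length ps * min k (length ps) * j)"
proof -
  define n where "n = length ps"
  define m where "m = min k n"
  have n: "1 \<le> n"
    using assms by (simp add: n_def Suc_le_eq)
  let ?prs = "result (map_tm (\<lambda>p. do { r \<leftarrow> fair_radius_tm d k ps n p; return (p, r) }) ps)"
  let ?D = "result (pairwise_dists_tm d ps ps)"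
  define F where "F = 4 * n * j + n * (m + 2) + 3"
  have F: "time (fair_center_tm d k \<alpha> \<Delta> ?prs) \<le> F" for \<Delta>
    using time_fair_center_tm[of ?prs j d k \<alpha> \<Delta>] assms by (simp add: F_def n_def m_def)
  \<comment> \<open>With n^2 candidates, 2 j halvings suffice.\<close>
  have "n * n < 2 ^ (2 * j)"
    using mult_strict_mono'[OF assms(3) assms(3)] by (simp add: n_def mult_2 power_add)
  then have search: "time (search_tm (n * n) d k \<alpha> ?prs ?D None) \<le> 4010 * (n * n) + (F + 15000) * (2 * j) + 1"
    using time_search_tm[of d k \<alpha> ?prs F ?D "2 * j" "n * n" None] F by (simp add: n_def)
  define R where "R = time (map_tm (\<lambda>p. do { r \<leftarrow> fair_radius_tm d k ps n p; return (p, r) }) ps)"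
  have "R \<le> length ps * (2002 * n + 10409 + 1) + 1"
    unfolding R_def by (rule time_map_tm) (use time_fair_radius_tm[OF assms(1,2)] in \<open>simp add: n_def\<close>)
  then have R: "R \<le> n * (2002 * n + 10410) + 1"
    by (simp add: n_def add.commute)
  have pairs: "time (pairwise_dists_tm d ps ps) \<le> n * (2 * n + 3) + 1"
    using time_pairwise_dists_tm[of d ps ps] by (simp add: n_def)
  have "time (approx_fair_center_tm d k \<alpha> ps) = 1 + (n + 1) + time (pairwise_dists_tm d ps ps)
      + R + (n * n + 1) + time (search_tm (n * n) d k \<alpha> ?prs ?D None)"
    by (simp add: approx_fair_center_tm_def n_def R_def)
  also have "\<dots> \<le> 1 + (n + 1) + (n * (2 * n + 3) + 1)
      + (n * (2002 * n + 10410) + 1) + (n * n + 1) + (4010 * (n * n) + (F + 15000) * (2 * j) + 1)"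
    by (intro add_mono order_refl R pairs search)
  also have "\<dots> = 6015 * (n * n) + 10414 * n + 6 + 8 * (n * j\<^sup>2) + 2 * (n * m * j) + 4 * (n * j) + 30006 * j"
    by (simp add: F_def power2_eq_square algebra_simps)
  also have "\<dots> \<le> 100000 * (n * n) + 2 * (n * m * j)"
  proof -
    \<comment> \<open>Repeated sorting contributes the term n j^2, which is at most 4 n^2 because
      j^2 <= 2 * 2^j <= 4 n.\<close>
    have "j\<^sup>2 \<le> 4 * n" "j \<le> 2 * n"
      using square_le_two_power[of j] less_exp[of j] assms(4) unfolding n_def by linarith+
    then have "n * j\<^sup>2 \<le> 4 * (n * n)" "n * j \<le> 2 * (n * n)" "j \<le> 2 * n"
      using mult_le_mono2[of "j\<^sup>2" "4 * n" n] mult_le_mono2[of j "2 * n" n] by simp_all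
    moreover have "n \<le> n * n"
      by simp
    ultimately show ?thesis
      using n by linarith
  qed
  finally show ?thesis
    by (simp add: n_def m_def power2_eq_square)
qed

lemma real_time_approx_fair_center_tm:
  assumes "0 < k" "ps \<noteq> []"
  shows "real (time (approx_fair_center_tm d k \<alpha> ps)) \<le>
    100002 * (real (length ps) ^ 2 + real k * real (length ps) * log 2 (real (length ps)))"
proof -
  define n where "n = length ps"
  define j where "j = floorlog 2 n"
  let ?m = "min k n"
  have n: "1 \<le> n"
    using assms by (simp add: n_def Suc_le_eq)
  have j: "2 ^ (j - 1) \<le> n" "n < 2 ^ j"
    using floorlog_bounds[of n 2] n by (auto simp: j_def)
  have "1 \<le> j"
    using j n by (cases j) auto
  then have "2 ^ j = 2 * (2 :: nat) ^ (j - 1)"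
    by (cases j) auto
  then have "2 ^ j \<le> 2 * n"
    using j(1) by linarith
  then have T: "time (approx_fair_center_tm d k \<alpha> ps) \<le> 100000 * n\<^sup>2 + 2 * (n * ?m * j)"
    using j(2) unfolding n_def by (intro time_approx_fair_center_tm assms)
  have "2 ^ (j - 1) \<le> real n"
    using of_nat_mono[OF j(1), where 'a = real] by simp
  then have "real (j - 1) \<le> log 2 (real n)"
    by (intro le_log_of_power) simp_all
  then have log: "real j \<le> 1 + log 2 (real n)" "0 \<le> log 2 (real n)"
    using \<open>1 \<le> j\<close> n by auto
  have "real (n * ?m * j) \<le> real n * real ?m * (1 + log 2 (real n))"
    using log by (simp add: mult_left_mono)
  also have "\<dots> = real n * real ?m + real n * real ?m * log 2 (real n)"
    by (simp add: algebra_simps)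
  \<comment> \<open>The minimum is bounded by n in the rounding term and by k in the logarithmic
    one. The rounding term has to go into n^2, as log n vanishes for n = 1.\<close>
  also have "\<dots> \<le> real n * real n + real n * real k * log 2 (real n)"
    using log by (intro add_mono mult_mono) auto
  finally have "real (n * ?m * j) \<le> real n ^ 2 + real k * real n * log 2 (real n)"
    by (simp add: power2_eq_square mult_ac)
  moreover have "real (time (approx_fair_center_tm d k \<alpha> ps)) \<le> 100000 * real n ^ 2 + 2 * real (n * ?m * j)"
    using of_nat_mono[OF T, where 'a = real] by simp
  moreover have "0 \<le> real k * real n * log 2 (real n)"
    using log by simp
  ultimately show ?thesis
    unfolding n_def by (simp add: distrib_left)
qed

text \<open>The constant is chosen before the instance, as the O-notation demands. The last conjunct
  concerns the mathematical procedure under any order sorted by fair radius, whereas the program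
  does its own sorting.\<close>

theorem theorem1:
  "\<exists>c::real. 0 < c \<and>
     (\<forall>(P :: 'a set) d k \<alpha> ps.
        Metric_space P d \<and> finite P \<and> P \<noteq> {} \<and> 0 < \<alpha> \<and>
        (\<exists>C. feasible P d \<alpha> k C) \<and>
        distinct ps \<and> set ps = P \<longrightarrow>
        (\<exists>C. result (approx_fair_center_tm d k \<alpha> ps) = Some C \<and>
             approximation 2 2 P d \<alpha> k (set C)) \<and>
        real (time (approx_fair_center_tm d k \<alpha> ps)) \<le>
          c * (real (card P) ^ 2 + real k * real (card P) * log 2 (real (card P))) \<and>
        (sorted (map (fair_radius P d k) ps) \<longrightarrow>
           (\<exists>C. approx_fair_center d k \<alpha> ps = Some C \<and> approximation 2 2 P d \<alpha> k C)))"
proof (rule exI[of _ 100002], rule conjI)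
  show "\<forall>(P :: 'a set) d k \<alpha> ps.
        Metric_space P d \<and> finite P \<and> P \<noteq> {} \<and> 0 < \<alpha> \<and>
        (\<exists>C. feasible P d \<alpha> k C) \<and>
        distinct ps \<and> set ps = P \<longrightarrow>
        (\<exists>C. result (approx_fair_center_tm d k \<alpha> ps) = Some C \<and>
             approximation 2 2 P d \<alpha> k (set C)) \<and>
        real (time (approx_fair_center_tm d k \<alpha> ps)) \<le>
          100002 * (real (card P) ^ 2 + real k * real (card P) * log 2 (real (card P))) \<and>
        (sorted (map (fair_radius P d k) ps) \<longrightarrow>
           (\<exists>C. approx_fair_center d k \<alpha> ps = Some C \<and> approximation 2 2 P d \<alpha> k C))"
    (is "\<forall>P d k \<alpha> ps. ?A P d k \<alpha> ps \<longrightarrow> ?B P d k \<alpha> ps \<and> ?T P d k \<alpha> ps \<and> ?S P d k \<alpha> ps")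
  proof (intro allI impI)
    fix P :: "'a set" and d k \<alpha> ps
    assume *: "?A P d k \<alpha> ps"
    then interpret Metric_space P d
      by blast
    obtain C where "feasible P d \<alpha> k C"
      using * by blast
    then have k: "0 < k"
      using feasible_nonempty(4)[of P d \<alpha> k C] * by blast
    have ps: "ps \<noteq> []" "card P = length ps"
      using * distinct_card[of ps] by auto
    have "?B P d k \<alpha> ps"
      by (rule approximation_approx_fair_center_tm) (use * in blast)+
    moreover have "?T P d k \<alpha> ps"
      unfolding ps(2) by (rule real_time_approx_fair_center_tm[OF k ps(1)])
    moreover have "?S P d k \<alpha> ps"
      using * by (intro impI approximation_approx_fair_center) blast+
    ultimately show "?B P d k \<alpha> ps \<and> ?T P d k \<alpha> ps \<and> ?S P d k \<alpha> ps"
      by blast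
  qed
qed simp

end
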